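(* Let $\Omega_N$ and $\Omega_N'$ be two finite connected networks, both with $N$ nodes, with $\alpha$-arrays $AF=(\alpha_1,\dots,\alpha_{N-1})$ and $AF'=(\alpha_1',\dots,\alpha_{N-1}')$ respectively. Let $d_N,\mu_N,Md_N$ be the diameter, average distance and median distance of $\Omega_N$, and $d_N',\mu_N',(Md_N)'$ those of $\Omega_N'$. If $AF$ is majorized by $AF'$, written $AF -\!\!< AF'$, then: (a) $d_N\ge d_N'$; (b) $\mu_N\ge\mu_N'$; (c) $Md_N\ge (Md_N)'$. (d) The opposite implications do not hold: none of the inequalities $d_N\ge d_N'$, $\mu_N\ge\mu_N'$, $Md_N\ge (Md_N)'$ implies in general that $AF -\!\!< AF'$.
   Context: A network is a finite connected graph; the distance between two nodes is the length of a shortest path between them. For a network with $N$ nodes, $\alpha_j$ ($j=1,\dots,N-1$) denotes the number of times distance $j$ occurs in the network (counted over unordered pairs of distinct nodes); the array $AF=(\alpha_1,\dots,\alpha_{N-1})$ is called its $\alpha$-array, and $\sum_{j=1}^{N-1}\alpha_j=\frac{N(N-1)}{2}$. The diameter $d_N$ is the largest distance between two nodes, i.e. the largest index $i$ with $\alpha_i\neq 0$; the average distance is $\mu_N=\frac{2}{N(N-1)}\sum_{i=1}^{N-1} i\,\alpha_i$; and $Md_N$ is the median of the multiset of the $\frac{N(N-1)}{2}$ distances between distinct nodes. Majorization is defined as follows. Let $X=(x_1,\dots,x_M)$ and $X'=(x_1',\dots,x_M')$ be $M$-arrays of non-negative real numbers, ranked in decreasing order. Then $X$ is majorized by $X'$,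 denoted $X -\!\!< X'$, if $\sum_{j=1}^{k}x_j\le\sum_{j=1}^{k}x_j'$ for $k=1,\dots,M-1$ and $\sum_{j=1}^{M}x_j=\sum_{j=1}^{M}x_j'$. This is applied to $\alpha$-arrays of $N$-node networks with $M=N-1$ (the equality of total sums then holds automatically, both being $\frac{N(N-1)}{2}$). *)

theory Defs
  imports "Graph_Theory.Graph_Theory" "HOL-Library.Multiset"
begin

text \<open>Undirected simple graphs are the symmetric, loop-free digraphs without parallel arcs
  of the locale \<^locale>\<open>graph\<close>; an edge is a pair of opposite arcs.\<close>

definition network :: "('a, 'b) pre_digraph \<Rightarrow> bool" where
  "network G \<longleftrightarrow> graph G \<and> connected G"

definition order :: "('a, 'b) pre_digraph \<Rightarrow> nat" where
  "order G = card (verts G)"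

definition node_dist :: "('a, 'b) pre_digraph \<Rightarrow> 'a \<Rightarrow> 'a \<Rightarrow> nat" where
  "node_dist G u v = (LEAST n. \<exists>p. pre_digraph.apath G u p v \<and> length p = n)"

definition node_pairs :: "('a, 'b) pre_digraph \<Rightarrow> 'a set set" where
  "node_pairs G = {e. e \<subseteq> verts G \<and> card e = 2}"

text \<open>The description below is proper because the distance in a network is symmetric.\<close>

definition pair_dist :: "('a, 'b) pre_digraph \<Rightarrow> 'a set \<Rightarrow> nat" where
  "pair_dist G e = (THE n. \<exists>u v. e = {u, v} \<and> n = node_dist G u v)"

definition distances :: "('a, 'b) pre_digraph \<Rightarrow> nat multiset" where
  "distances G = image_mset (pair_dist G) (mset_set (node_pairs G))"

text \<open>The \<open>\<alpha>\<close>-array consists of the values at the indices \<open>1, \<dots>, N - 1\<close>.\<close>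

definition alpha :: "('a, 'b) pre_digraph \<Rightarrow> nat \<Rightarrow> nat" where
  "alpha G j = count (distances G) j"

definition diameter :: "('a, 'b) pre_digraph \<Rightarrow> nat" where
  "diameter G = Max {node_dist G u v | u v. u \<in> verts G \<and> v \<in> verts G}"

definition avg_dist :: "('a, 'b) pre_digraph \<Rightarrow> real" where
  "avg_dist G = 2 / (real (order G) * (real (order G) - 1)) *
     (\<Sum>i = 1..order G - 1. real i * real (alpha G i))"

definition median :: "nat multiset \<Rightarrow> real" where
  "median A = (let xs = sorted_list_of_multiset A; n = size A in
     if odd n then real (xs ! (n div 2))
     else (real (xs ! (n div 2 - 1)) + real (xs ! (n div 2))) / 2)"

definition median_dist :: "('a, 'b) pre_digraph \<Rightarrow> real" where
  "median_dist G = median (distances G)"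

text \<open>Majorization compares partial sums of \<open>M\<close>-arrays indexed by \<open>1, \<dots>, M\<close>, which are
  classically assumed to be ranked in decreasing order. The ranking is not part of the definition:
  partial sums are taken in the given order (for \<open>\<alpha>\<close>-arrays, by increasing distance), as
  \<open>\<alpha>\<close>-arrays need not be decreasing. On decreasing arrays this is the classical notion.
  Arrays must not be sorted first: on five nodes, the star has \<open>\<alpha>\<close>-array \<open>(4, 6, 0, 0)\<close> and
  the star with two further edges \<open>(6, 4, 0, 0)\<close>; sorted, these arrays would majorize each other
  although the average distances differ.\<close>

definition majorized :: "nat \<Rightarrow> (nat \<Rightarrow> real) \<Rightarrow> (nat \<Rightarrow> real) \<Rightarrow> bool" where
  "majorized M x x' \<longleftrightarrow>
     (\<forall>k \<in> {1..M - 1}. (\<Sum>j = 1..k. x j) \<le> (\<Sum>j = 1..k. x' j)) \<and>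
     (\<Sum>j = 1..M. x j) = (\<Sum>j = 1..M. x' j)"

definition ranked :: "nat \<Rightarrow> (nat \<Rightarrow> real) \<Rightarrow> bool" where
  "ranked M x \<longleftrightarrow> antimono_on {1..M} x"

end

theory Submission
  imports Defs
begin

text \<open>Majorization of the \<open>\<alpha>\<close>-arrays says that for every \<open>k\<close> the second network has at least as
  many distances \<open>\<le> k\<close> as the first. As both have the same number of distances, the sorted
  list of distances of the first network dominates that of the second one entrywise, so its
  maximum, mean and median are at least as large.

  No converse holds because of two networks on five nodes: the path with four nodes one of whose inner
  nodes is doubled into an edge, with \<open>\<alpha>\<close>-array \<open>(6, 3, 1, 0)\<close>, and the cycle, with
  \<open>\<alpha>\<close>-array \<open>(5, 5, 0, 0)\<close>. Their partial sums cross, so neither array is majorized by the other,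
  while the average distances agree, the diameters are \<open>3 > 2\<close> and the medians are \<open>1 < 3/2\<close>.\<close>

section \<open>Sorted lists\<close>

text \<open>Counting: if \<open>ys ! i\<close> exceeded \<open>xs ! i\<close>, then by sortedness at
  most \<open>i\<close> entries of \<open>ys\<close> would be \<le> \<open>xs ! i\<close>, while
  \<open>xs\<close> has at least \<open>Suc i\<close> such entries.\<close>

lemma sorted_nth_le_if_filter_le:
  fixes xs ys :: "'a::linorder list"
  assumes "sorted xs" "sorted ys" "length xs = length ys" "i < length xs"
    and le: "\<And>k. length (filter (\<lambda>x. x \<le> k) xs) \<le> length (filter (\<lambda>x. x \<le> k) ys)"
  shows "ys ! i \<le> xs ! i"
proof (rule ccontr)
  assume "\<not> ys ! i \<le> xs ! i"
  then have "{j. j < length ys \<and> ys ! j \<le> xs ! i} \<subseteq> {..<i}"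
    using sorted_nth_mono[OF assms(2), of i] by (fastforce simp: not_le[symmetric])
  then have "length (filter (\<lambda>x. x \<le> xs ! i) ys) \<le> i"
    using card_mono[of "{..<i}"] by (simp add: length_filter_conv_card)
  moreover have "{..i} \<subseteq> {j. j < length xs \<and> xs ! j \<le> xs ! i}"
    using assms(1,4) by (auto intro: sorted_nth_mono)
  then have "Suc i \<le> length (filter (\<lambda>x. x \<le> xs ! i) xs)"
    using card_mono[of "{j. j < length xs \<and> xs ! j \<le> xs ! i}" "{..i}"]
    by (simp add: length_filter_conv_card)
  ultimately show False
    using le[of "xs ! i"] by linarith
qed

lemma length_filter_sorted_list_of_multiset:
  "length (filter P (sorted_list_of_multiset A)) = size (filter_mset P A)"
  by (metis mset_filter mset_sorted_list_of_multiset size_mset)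

lemma sorted_list_of_multiset_nth_le:
  fixes A B :: "'a::linorder multiset"
  assumes "size A = size B" "i < size A"
    and "\<And>k. size {#d \<in># A. d \<le> k#} \<le> size {#d \<in># B. d \<le> k#}"
  shows "sorted_list_of_multiset B ! i \<le> sorted_list_of_multiset A ! i"
  using assms
  by (intro sorted_nth_le_if_filter_le)
     (auto simp: length_filter_sorted_list_of_multiset size_mset[symmetric] simp del: size_mset)

text \<open>The positions that \<open>median\<close> reads depend only on the size, so the entrywise
  comparison of the sorted lists applies to them.\<close>

lemma median_mono:
  assumes "size A = size B"
    and "\<And>k. size {#d \<in># A. d \<le> k#} \<le> size {#d \<in># B. d \<le> k#}"
  shows "median B \<le> median A"
proof (cases "size A = 0")
  case True
  \<comment> \<open>Both multisets are empty, hence equal, so the out-of-range values in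
    \<open>median\<close> coincide.\<close>
  then show ?thesis using assms(1) by (metis order_refl size_eq_0_iff_empty)
next
  case False
  then have "size A div 2 < size A" "size A div 2 - 1 < size A" by linarith+
  with sorted_list_of_multiset_nth_le[of A B, OF assms(1) _ assms(2)] show ?thesis
    unfolding median_def Let_def assms(1)[symmetric] by (auto intro!: add_mono divide_right_mono)
qed

lemma sum_mset_mono_if_filter_le:
  fixes A B :: "nat multiset"
  assumes "size A = size B"
    and "\<And>k. size {#d \<in># A. d \<le> k#} \<le> size {#d \<in># B. d \<le> k#}"
  shows "sum_mset B \<le> sum_mset A"
proof -
  have sum: "sum_mset C = (\<Sum>i<size C. sorted_list_of_multiset C ! i)" for C :: "nat multiset"
  proof -
    have "sum_mset C = sum_list (sorted_list_of_multiset C)"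
      by (metis mset_sorted_list_of_multiset sum_mset_sum_list)
    also have "length (sorted_list_of_multiset C) = size C"
      by (metis mset_sorted_list_of_multiset size_mset)
    then have "sum_list (sorted_list_of_multiset C) = (\<Sum>i<size C. sorted_list_of_multiset C ! i)"
      by (simp add: sum_list_sum_nth atLeast0LessThan)
    finally show ?thesis .
  qed
  show ?thesis
    unfolding sum assms(1)[symmetric]
    by (intro sum_mono sorted_list_of_multiset_nth_le assms) simp
qed

text \<open>The entry of \<open>A\<close> at the position of \<open>b\<close> in the sorted list of
  \<open>B\<close> serves as \<open>a\<close>. With \<open>b\<close> the largest distance this
  yields the diameter inequality.\<close>

lemma ex_ge_mset_if_filter_le:
  fixes A B :: "nat multiset"
  assumes "size A = size B" "b \<in># B"
    and "\<And>k. size {#d \<in># A. d \<le> k#} \<le> size {#d \<in># B. d \<le> k#}"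
  obtains a where "a \<in># A" "b \<le> a"
proof -
  have len: "length (sorted_list_of_multiset C) = size C" for C :: "nat multiset"
    by (metis mset_sorted_list_of_multiset size_mset)
  from assms(2) obtain i where i: "i < size B" "b = sorted_list_of_multiset B ! i"
    by (metis in_set_conv_nth len set_sorted_list_of_multiset)
  then have "sorted_list_of_multiset A ! i \<in># A"
    by (metis assms(1) len nth_mem set_sorted_list_of_multiset)
  then show thesis
    using that sorted_list_of_multiset_nth_le[of A B i] assms i by metis
qed

lemma sum_mset_eq_sum_count:
  fixes M :: "nat multiset"
  assumes "finite S" "set_mset M \<subseteq> S"
  shows "sum_mset M = (\<Sum>i\<in>S. i * count M i)"
  using assms(2)
proof (induction M)
  case (add x M)
  have "(\<Sum>i\<in>S. i * count (add_mset x M) i) = (\<Sum>i\<in>S. i * count M i + (if i = x then x else 0))"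
    by (intro sum.cong) auto
  with add assms(1) show ?case by (simp add: sum.distrib)
qed simp

section \<open>Distances in networks\<close>

context wf_digraph
begin

text \<open>\<open>node_dist\<close> minimizes over paths without repeated nodes; a walk is reduced
  to such a path by cutting out cycles (here \<open>r\<close>), which never lengthens it.\<close>

lemma node_dist_le_length: "awalk u p v \<Longrightarrow> node_dist G u v \<le> length p"
proof (induction p rule: awalk_to_apath_induct)
  case (path p)
  then show ?case
    unfolding node_dist_def by (intro Least_le) (auto simp: apath_def)
next
  case (decomp p q r s)
  then have "p = q @ r @ s" by (auto elim: awalk_cyc_decompE)
  with decomp show ?case by simp
qed

lemma node_dist_attained:
  assumes "u \<rightarrow>\<^sup>* v"
  obtains p where "apath u p v" "length p = node_dist G u v"
proof -
  from assms obtain p where "awalk u p v" by (auto simp: reachable_awalk)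
  then have "\<exists>n p. apath u p v \<and> length p = n" by (blast intro: apath_awalk_to_apath)
  from LeastI_ex[OF this] show thesis
    using that unfolding node_dist_def by blast
qed

lemma node_dist_self: "u \<in> verts G \<Longrightarrow> node_dist G u u = 0"
  using node_dist_le_length[of u "[]" u] by (simp add: awalk_Nil_iff)

end

text \<open>Every arc has an opposite one; the opposite of the first arc is appended to the reversed
  rest. This gives the symmetry of the distance.\<close>

lemma (in sym_digraph) awalk_reverse:
  "awalk u p v \<Longrightarrow> \<exists>q. awalk v q u \<and> length q = length p"
proof (induction p arbitrary: u)
  case Nil
  then show ?case by (auto simp: awalk_Nil_iff)
next
  case (Cons e es)
  then have e: "e \<in> arcs G" "u = tail G e" "awalk (head G e) es v"
    by (auto simp: awalk_Cons_iff)
  with Cons.IH obtain q where q: "awalk v q (head G e)" "length q = length es" by blast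
  from e(1) sym_arcs obtain e' where e': "e' \<in> arcs G" "tail G e' = head G e" "head G e' = tail G e"
    unfolding symmetric_conv by metis
  then have "awalk (head G e) [e'] u"
    using arc_implies_awalk[of e'] e(2) by simp
  with q have "awalk v (q @ [e']) u" by (intro awalk_appendI)
  with q(2) show ?case by (intro exI[of _ "q @ [e']"]) simp
qed

locale network_graph =
  fixes G :: "('a, 'b) pre_digraph" (structure)
  assumes network: "network G"

sublocale network_graph \<subseteq> graph G
  using network by (simp add: network_def)

context network_graph
begin

text \<open>Connectedness is strong connectedness of the symmetric closure; since the arcs are
  already symmetric, it carries over to \<open>G\<close> itself.\<close>

lemma reachable: "u \<in> verts G \<Longrightarrow> v \<in> verts G \<Longrightarrow> u \<rightarrow>\<^sup>* v"
  and verts_nonempty: "verts G \<noteq> {}"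
  using network symmetric_connected_imp_strongly_connected[OF sym_arcs]
  by (simp_all add: network_def strongly_connected_def)

lemma node_dist_sym:
  assumes "u \<in> verts G" "v \<in> verts G"
  shows "node_dist G u v = node_dist G v u"
proof -
  have "node_dist G y x \<le> node_dist G x y" if "x \<in> verts G" "y \<in> verts G" for x y
    using node_dist_attained[OF reachable[OF that]] awalk_reverse node_dist_le_length
    by (metis awalkI_apath)
  then show ?thesis using assms by (simp add: order_antisym)
qed

text \<open>A shortest path repeats no node, so it has fewer arcs than the network has
  nodes.\<close>

lemma node_dist_less_order: "u \<in> verts G \<Longrightarrow> v \<in> verts G \<Longrightarrow> node_dist G u v < order G"
  using node_dist_attained[OF reachable] length_apath_less unfolding order_def by metis

lemma node_dist_pos: "u \<in> verts G \<Longrightarrow> v \<in> verts G \<Longrightarrow> u \<noteq> v \<Longrightarrow> 0 < node_dist G u v"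
  using node_dist_attained[OF reachable]
  by (metis apath_Nil_iff gr0I length_0_conv)

lemma pair_dist_eq: "u \<in> verts G \<Longrightarrow> v \<in> verts G \<Longrightarrow> pair_dist G {u, v} = node_dist G u v"
  unfolding pair_dist_def by (rule the_equality) (auto simp: doubleton_eq_iff node_dist_sym)

lemma finite_node_pairs: "finite (node_pairs G)"
  by (rule finite_subset[of _ "Pow (verts G)"]) (auto simp: node_pairs_def)

lemma size_distances: "size (distances G) = order G choose 2"
  by (simp add: distances_def node_pairs_def order_def n_subsets)

lemma in_distances_iff:
  "d \<in># distances G \<longleftrightarrow> (\<exists>u\<in>verts G. \<exists>v\<in>verts G. u \<noteq> v \<and> d = node_dist G u v)"
proof -
  have "d \<in># distances G \<longleftrightarrow> d \<in> pair_dist G ` node_pairs G"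
    using finite_node_pairs by (simp add: distances_def)
  also have "\<dots> \<longleftrightarrow> (\<exists>u\<in>verts G. \<exists>v\<in>verts G. u \<noteq> v \<and> d = node_dist G u v)"
  proof
    assume "d \<in> pair_dist G ` node_pairs G"
    then obtain u v where "u \<noteq> v" "u \<in> verts G" "v \<in> verts G" "d = pair_dist G {u, v}"
      by (auto simp: node_pairs_def card_2_iff)
    then show "\<exists>u\<in>verts G. \<exists>v\<in>verts G. u \<noteq> v \<and> d = node_dist G u v"
      using pair_dist_eq by blast
  next
    assume "\<exists>u\<in>verts G. \<exists>v\<in>verts G. u \<noteq> v \<and> d = node_dist G u v"
    then obtain u v where uv: "u \<noteq> v" "u \<in> verts G" "v \<in> verts G" "d = node_dist G u v"
      by blast
    then have "{u, v} \<in> node_pairs G" by (simp add: node_pairs_def)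
    with uv show "d \<in> pair_dist G ` node_pairs G" by (auto simp: pair_dist_eq[symmetric])
  qed
  finally show ?thesis .
qed

lemma distances_bounds: "d \<in># distances G \<Longrightarrow> 1 \<le> d \<and> d \<le> order G - 1"
  using node_dist_less_order node_dist_pos by (fastforce simp: in_distances_iff Suc_le_eq)

text \<open>The link between majorization and multisets. Distances of distinct nodes are positive,
  so a sum starting at 1 misses none of them.\<close>

lemma size_distances_le:
  assumes "k \<le> order G - 1"
  shows "size {#d \<in># distances G. d \<le> k#} = (\<Sum>j = 1..k. alpha G j)"
proof -
  have "size {#d \<in># distances G. d \<le> k#} =
      (\<Sum>j\<in>set_mset {#d \<in># distances G. d \<le> k#}. count {#d \<in># distances G. d \<le> k#} j)"
    by (rule size_multiset_overloaded_eq)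
  also have "\<dots> = (\<Sum>j = 1..k. count {#d \<in># distances G. d \<le> k#} j)"
    using distances_bounds by (intro sum.mono_neutral_left) (auto simp: not_in_iff[symmetric])
  finally show ?thesis by (simp add: alpha_def)
qed

lemma size_distances_le_all:
  assumes "order G - 1 \<le> k"
  shows "size {#d \<in># distances G. d \<le> k#} = order G choose 2"
proof -
  have "{#d \<in># distances G. d \<le> k#} = {#d \<in># distances G. True#}"
    using distances_bounds assms by (intro filter_mset_cong) (auto intro: order_trans)
  then show ?thesis by (simp add: size_distances)
qed

lemma sum_mset_distances: "sum_mset (distances G) = (\<Sum>i = 1..order G - 1. i * alpha G i)"
  using distances_bounds unfolding alpha_def
  by (intro sum_mset_eq_sum_count) auto

lemma avg_dist_eq:
  "avg_dist G = 2 / (real (order G) * (real (order G) - 1)) * real (sum_mset (distances G))"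
  unfolding avg_dist_def sum_mset_distances by simp

lemma finite_node_dists: "finite {node_dist G u v | u v. u \<in> verts G \<and> v \<in> verts G}"
  by (rule finite_subset[of _ "{..<order G}"]) (auto intro: node_dist_less_order)

lemma diameter_ge: "d \<in># distances G \<Longrightarrow> d \<le> diameter G"
  unfolding diameter_def using finite_node_dists by (intro Max_ge) (auto simp: in_distances_iff)

text \<open>The maximum in \<open>diameter\<close> also ranges over equal nodes, which
  \<open>distances\<close> leaves out; they contribute only the value 0.\<close>

lemma diameter_in_distances: "diameter G = 0 \<or> diameter G \<in># distances G"
proof -
  have "diameter G \<in> {node_dist G u v | u v. u \<in> verts G \<and> v \<in> verts G}"
    unfolding diameter_def using finite_node_dists verts_nonempty by (intro Max_in) auto
  then obtain u v where uv: "u \<in> verts G" "v \<in> verts G" "diameter G = node_dist G u v"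
    by blast
  show ?thesis
  proof (cases "u = v")
    case True
    then show ?thesis using uv node_dist_self by simp
  next
    case False
    then have "diameter G \<in># distances G" unfolding in_distances_iff using uv by blast
    then show ?thesis ..
  qed
qed

end

section \<open>Majorization implies the three inequalities\<close>

text \<open>Majorization compares partial sums only for \<open>k\<close> from 1 to
  \<open>order G - 1 - 1\<close>. At 0 no distance is counted, and from \<open>order G - 1\<close>
  on both counts are the total \<open>order G choose 2\<close>.\<close>

lemma majorized_distances:
  assumes "network G" "network G'" "order G = order G'"
    and maj: "majorized (order G - 1) (real \<circ> alpha G) (real \<circ> alpha G')"
  shows "size {#d \<in># distances G. d \<le> k#} \<le> size {#d \<in># distances G'. d \<le> k#}"
proof -
  interpret G: network_graph G by unfold_locales fact
  interpret G': network_graph G' by unfold_locales fact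
  consider "k = 0" | "k \<in> {1..order G - 1 - 1}" | "order G - 1 \<le> k" by force
  then show ?thesis
  proof cases
    case 1
    have "size {#d \<in># distances G. d \<le> 0#} = 0"
      using G.size_distances_le[of 0] by (simp del: le_zero_eq)
    then show ?thesis unfolding 1 by linarith
  next
    case 2
    with maj have "real (\<Sum>j = 1..k. alpha G j) \<le> real (\<Sum>j = 1..k. alpha G' j)"
      by (auto simp: majorized_def)
    moreover have "k \<le> order G - 1" "k \<le> order G' - 1"
      using 2 assms(3) by auto
    ultimately show ?thesis
      by (simp add: G.size_distances_le G'.size_distances_le del: of_nat_sum)
  next
    case 3
    then show ?thesis
      using assms(3) by (simp add: G.size_distances_le_all G'.size_distances_le_all)
  qed
qed

lemma majorized_network_le:
  assumes "network G" "network G'" "order G = order G'"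
    and "majorized (order G - 1) (real \<circ> alpha G) (real \<circ> alpha G')"
  shows "diameter G' \<le> diameter G" "avg_dist G' \<le> avg_dist G" "median_dist G' \<le> median_dist G"
proof -
  interpret G: network_graph G by unfold_locales fact
  interpret G': network_graph G' by unfold_locales fact
  note le = majorized_distances[OF assms]
  have size: "size (distances G) = size (distances G')"
    using assms(3) by (simp add: G.size_distances G'.size_distances)
  show "diameter G' \<le> diameter G"
    using G'.diameter_in_distances
  proof
    assume "diameter G' \<in># distances G'"
    then obtain d where "d \<in># distances G" "diameter G' \<le> d"
      by (rule ex_ge_mset_if_filter_le[OF size _ le])
    then show ?thesis using G.diameter_ge by force
  qed simp
  show "median_dist G' \<le> median_dist G"
    unfolding median_dist_def by (intro median_mono size le)
  \<comment> \<open>The split makes the denominator 0 or \<open>real (Suc n) * real n\<close>; for a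
    single node it is 0 and the quotient is 0 by convention.\<close>
  have "0 \<le> 2 / (real (order G) * (real (order G) - 1))"
    by (cases "order G") auto
  then show "avg_dist G' \<le> avg_dist G"
    unfolding G.avg_dist_eq G'.avg_dist_eq assms(3)[symmetric]
    by (intro mult_left_mono of_nat_mono sum_mset_mono_if_filter_le[OF size le])
qed

section \<open>Networks given by a distance table\<close>

text \<open>Lists the index pairs column by column, so that for a concrete \<open>n\<close> the
  distances can be evaluated.\<close>

lemma mset_set_upper_pairs:
  "mset_set {(u, v). u < v \<and> v < (n::nat)} =
     mset (concat (map (\<lambda>v. map (\<lambda>u. (u, v)) [0..<v]) [0..<n]))"
proof -
  have "distinct (concat (map (\<lambda>v. map (\<lambda>u. (u, v)) [0..<v]) [0..<n]))"
    by (induction n) (auto simp: distinct_map inj_on_def)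
  note mset_set_set[OF this]
  moreover have "set (concat (map (\<lambda>v. map (\<lambda>u. (u, v)) [0..<v]) [0..<n])) = {(u, v). u < v \<and> v < n}"
    by auto
  ultimately show ?thesis by (simp only:)
qed

text \<open>Reading adjacency off the entries 1 lets one table give both the graph and its claimed
  distances; checking the claim is then a finite computation.\<close>

definition table_graph :: "nat list list \<Rightarrow> (nat, nat \<times> nat) pre_digraph" where
  "table_graph D = \<lparr>verts = {..<length D},
     arcs = {(u, v). u < length D \<and> v < length D \<and> D ! u ! v = 1}, tail = fst, head = snd\<rparr>"

text \<open>The last two conditions make the table the distance function of the graph: it changes by at
  most one along an edge, and decreases along some edge leaving \<open>u\<close>.\<close>

definition dist_table :: "nat list list \<Rightarrow> bool" where
  "dist_table D \<longleftrightarrow> D \<noteq> [] \<and>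
     (\<forall>u<length D. \<forall>v<length D. D ! u ! v = D ! v ! u \<and> (D ! u ! v = 0 \<longleftrightarrow> u = v) \<and>
       (\<forall>w<length D. D ! u ! w = 1 \<longrightarrow> D ! u ! v \<le> Suc (D ! w ! v)) \<and>
       (u \<noteq> v \<longrightarrow> (\<exists>w<length D. D ! u ! w = 1 \<and> D ! u ! v = Suc (D ! w ! v))))"

lemma table_graph_simps [simp]:
  "verts (table_graph D) = {..<length D}"
  "arcs (table_graph D) = {(u, v). u < length D \<and> v < length D \<and> D ! u ! v = 1}"
  "tail (table_graph D) = fst" "head (table_graph D) = snd"
  "order (table_graph D) = length D"
  by (simp_all add: table_graph_def order_def)

context
  fixes D :: "nat list list"
  assumes D: "dist_table D"
begin

lemma table_self: "u < length D \<Longrightarrow> D ! u ! u = 0"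
  using D unfolding dist_table_def by blast

interpretation graph "table_graph D"
proof
  show "finite (arcs (table_graph D))"
    by (rule finite_subset[of _ "{..<length D} \<times> {..<length D}"]) auto
  show "symmetric (table_graph D)"
    using D by (auto simp: symmetric_conv dist_table_def)
  show "tail (table_graph D) e \<noteq> head (table_graph D) e" if "e \<in> arcs (table_graph D)" for e
    using that table_self by (cases e) auto
qed (auto simp: arc_to_ends_def)

text \<open>Descent: some neighbour \<open>w\<close> of \<open>u\<close> has an entry smaller by
  one, and the entry 0 is reached only at \<open>v\<close>.\<close>

lemma ex_awalk_table_graph:
  assumes "u < length D" "v < length D"
  shows "\<exists>p. awalk u p v \<and> length p = D ! u ! v"
  using assms
proof (induction "D ! u ! v" arbitrary: u)
  case 0
  then have "u = v" using D by (simp add: dist_table_def)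
  then show ?case using 0 by (intro exI[of _ "[]"]) (simp add: awalk_Nil_iff)
next
  case (Suc n)
  then have "u \<noteq> v" using table_self by auto
  with D Suc.prems obtain w where w: "w < length D" "D ! u ! w = 1" "D ! u ! v = Suc (D ! w ! v)"
    unfolding dist_table_def by blast
  with Suc obtain p where "awalk w p v" "length p = n" by fastforce
  with w Suc show ?case
    by (intro exI[of _ "(u, w) # p"]) (simp add: awalk_Cons_iff)
qed

text \<open>Each arc lowers the entry towards \<open>v\<close> by at most one, and it is 0 at the
  end of the walk.\<close>

lemma table_le_length_awalk: "awalk u p v \<Longrightarrow> D ! u ! v \<le> length p"
proof (induction p arbitrary: u)
  case Nil
  then show ?case using D by (auto simp: awalk_Nil_iff dist_table_def)
next
  case (Cons e p)
  then obtain w where w: "e = (u, w)" "u < length D" "w < length D" "D ! u ! w = 1" "awalk w p v"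
    by (cases e) (auto simp: awalk_Cons_iff)
  moreover have "v < length D"
    using awalk_last_in_verts[OF w(5)] by simp
  ultimately have "D ! u ! v \<le> Suc (D ! w ! v)"
    using D w(2-4) unfolding dist_table_def by blast
  with Cons.IH[OF w(5)] show ?case by simp
qed

lemma network_table_graph: "network (table_graph D)"
  unfolding network_def
proof
  show "graph (table_graph D)" by unfold_locales
  show "connected (table_graph D)"
    unfolding connected_def
  proof (rule strongly_connectedI)
    show "verts (with_proj (mk_symmetric (table_graph D))) \<noteq> {}"
      using D by (auto simp: dist_table_def lessThan_empty_iff)
    fix u v
    assume "u \<in> verts (with_proj (mk_symmetric (table_graph D)))"
      "v \<in> verts (with_proj (mk_symmetric (table_graph D)))"
    then show "u \<rightarrow>\<^sup>*\<^bsub>with_proj (mk_symmetric (table_graph D))\<^esub> v"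
      using ex_awalk_table_graph[of u v] by (intro reachable_mk_symmetricI) (auto simp: reachable_awalk)
  qed
qed

interpretation network_graph "table_graph D"
  by unfold_locales (rule network_table_graph)

lemma node_dist_table_graph:
  assumes "u < length D" "v < length D"
  shows "node_dist (table_graph D) u v = D ! u ! v"
proof (rule antisym)
  show "node_dist (table_graph D) u v \<le> D ! u ! v"
    using ex_awalk_table_graph[OF assms] node_dist_le_length by force
  obtain p where "apath u p v" "length p = node_dist (table_graph D) u v"
    using node_dist_attained[OF reachable] assms by auto
  then show "D ! u ! v \<le> node_dist (table_graph D) u v"
    using table_le_length_awalk awalkI_apath by metis
qed

text \<open>Each unordered pair of nodes is represented by its increasing ordering, which is a
  bijection onto the index pairs with \<open>u < v\<close>.\<close>

lemma distances_table_graph: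
  "distances (table_graph D) =
     image_mset (\<lambda>(u, v). D ! u ! v) (mset_set {(u, v). u < v \<and> v < length D})"
proof -
  let ?P = "{(u, v). u < v \<and> v < length D}"
  let ?f = "\<lambda>(u::nat, v). {u, v}"
  have fin: "finite ?P"
    by (rule finite_subset[of _ "{..<length D} \<times> {..<length D}"]) auto
  have inj: "inj_on ?f ?P"
    by (auto simp: inj_on_def doubleton_eq_iff)
  have "node_pairs (table_graph D) = ?f ` ?P"
  proof (intro equalityI subsetI)
    fix e assume "e \<in> node_pairs (table_graph D)"
    then obtain u v where "e = {u, v}" "u \<noteq> v" "u < length D" "v < length D"
      by (auto simp: node_pairs_def card_2_iff)
    then have "e = ?f (min u v, max u v)" "(min u v, max u v) \<in> ?P"
      by (auto simp: min_def max_def)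
    then show "e \<in> ?f ` ?P" by blast
  qed (auto simp: node_pairs_def card_2_iff)
  then have "distances (table_graph D) = image_mset (pair_dist (table_graph D) \<circ> ?f) (mset_set ?P)"
    by (simp add: distances_def image_mset_mset_set[OF inj, symmetric] multiset.map_comp)
  also have "\<dots> = image_mset (\<lambda>(u, v). D ! u ! v) (mset_set ?P)"
    using fin by (intro image_mset_cong) (auto simp: pair_dist_eq node_dist_table_graph)
  finally show ?thesis .
qed


end

section \<open>The two networks on five nodes\<close>

lemma distances_table_graph_5:
  assumes "dist_table D" "length D = 5"
  shows "distances (table_graph D) = mset [D ! 0 ! 1, D ! 0 ! 2, D ! 1 ! 2, D ! 0 ! 3,
    D ! 1 ! 3, D ! 2 ! 3, D ! 0 ! 4, D ! 1 ! 4, D ! 2 ! 4, D ! 3 ! 4]"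
  unfolding distances_table_graph[OF assms(1)] mset_set_upper_pairs assms(2)
  by (simp add: eval_nat_numeral)

text \<open>The edges are 01, 12, 13, 23, 24, 34: the path 0, 1, 2, 4 with node 3 as an adjacent
  copy of node 2. Only 0 and 4 are at distance 3.\<close>

definition bulged_path :: "nat list list" where
  "bulged_path =
    [[0, 1, 2, 2, 3],
     [1, 0, 1, 1, 2],
     [2, 1, 0, 1, 1],
     [2, 1, 1, 0, 1],
     [3, 2, 1, 1, 0]]"

definition pentagon :: "nat list list" where
  "pentagon =
    [[0, 1, 2, 2, 1],
     [1, 0, 1, 2, 2],
     [2, 1, 0, 1, 2],
     [2, 2, 1, 0, 1],
     [1, 2, 2, 1, 0]]"

text \<open>Turns the bounded quantifiers of \<open>dist_table\<close> into finite conjunctions that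
  the simplifier can check.\<close>

lemma all_less_5: "(\<forall>i<5. P i) \<longleftrightarrow> P 0 \<and> P 1 \<and> P 2 \<and> P 3 \<and> P (4::nat)"
  by (simp add: eval_nat_numeral All_less_Suc conj_ac)

lemma ex_less_5: "(\<exists>i<5. P i) \<longleftrightarrow> P 0 \<or> P 1 \<or> P 2 \<or> P 3 \<or> P (4::nat)"
  using all_less_5[of "\<lambda>i. \<not> P i"] by blast

lemma length_examples: "length bulged_path = 5" "length pentagon = 5"
  by (simp_all add: bulged_path_def pentagon_def)

lemma dist_table_bulged_path: "dist_table bulged_path"
  \<comment> \<open>The quantifiers are expanded while the table is still folded; only then are its
    entries evaluated.\<close>
  by (simp add: dist_table_def all_less_5 ex_less_5 length_examples) (simp add: bulged_path_def)

lemma dist_table_pentagon: "dist_table pentagon"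
  by (simp add: dist_table_def all_less_5 ex_less_5 length_examples) (simp add: pentagon_def)

lemma distances_bulged_path:
  "distances (table_graph bulged_path) = mset [1, 1, 1, 1, 1, 1, 2, 2, 2, 3]"
  by (simp add: distances_table_graph_5 dist_table_bulged_path length_examples) (simp add: bulged_path_def)

lemma distances_pentagon:
  "distances (table_graph pentagon) = mset [1, 1, 1, 1, 1, 2, 2, 2, 2, 2]"
  by (simp add: distances_table_graph_5 dist_table_pentagon length_examples) (simp add: pentagon_def)

lemma diameter_bulged_path: "diameter (table_graph bulged_path) \<ge> 3"
proof -
  interpret network_graph "table_graph bulged_path"
    by unfold_locales (rule network_table_graph[OF dist_table_bulged_path])
  show ?thesis
    using diameter_ge[of 3] by (simp add: distances_bulged_path)
qed

lemma diameter_pentagon: "diameter (table_graph pentagon) \<le> 2"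
proof -
  interpret network_graph "table_graph pentagon"
    by unfold_locales (rule network_table_graph[OF dist_table_pentagon])
  show ?thesis
    using diameter_in_distances by (auto simp: distances_pentagon)
qed

lemma order_examples:
  "order (table_graph bulged_path) = 5" "order (table_graph pentagon) = 5"
  by (simp_all add: length_examples)

lemma atLeastAtMost_1_4: "{1..4::nat} = {1, 2, 3, 4}"
  by auto

text \<open>The index 1 appears as \<open>Suc 0\<close>, its simp normal form, so that the equations
  rewrite simplified sums.\<close>

lemma alpha_bulged_path:
  "alpha (table_graph bulged_path) (Suc 0) = 6"
  "alpha (table_graph bulged_path) 2 = 3" "alpha (table_graph bulged_path) 3 = 1"
  "alpha (table_graph bulged_path) 4 = 0"
  by (simp_all add: alpha_def distances_bulged_path)

lemma alpha_pentagon: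
  "alpha (table_graph pentagon) (Suc 0) = 5"
  "alpha (table_graph pentagon) 2 = 5" "alpha (table_graph pentagon) 3 = 0"
  "alpha (table_graph pentagon) 4 = 0"
  by (simp_all add: alpha_def distances_pentagon)

text \<open>Both arrays are decreasing, so the counterexamples also count for the classical notion
  of majorization.\<close>

lemma ranked_examples:
  "ranked 4 (real \<circ> alpha (table_graph bulged_path))"
  "ranked 4 (real \<circ> alpha (table_graph pentagon))"
  unfolding ranked_def monotone_on_def atLeastAtMost_1_4
  by (auto simp: alpha_bulged_path alpha_pentagon)

text \<open>The partial sums are 6, 9, 10, 10 and 5, 10, 10, 10: the first claim fails to be
  majorized at \<open>k = 1\<close>, the second at \<open>k = 2\<close>.\<close>

lemma not_majorized_examples:
  "\<not> majorized 4 (real \<circ> alpha (table_graph bulged_path)) (real \<circ> alpha (table_graph pentagon))"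
  "\<not> majorized 4 (real \<circ> alpha (table_graph pentagon)) (real \<circ> alpha (table_graph bulged_path))"
proof -
  have "{1..2::nat} = {1, 2}" by auto
  then show
    "\<not> majorized 4 (real \<circ> alpha (table_graph bulged_path)) (real \<circ> alpha (table_graph pentagon))"
    "\<not> majorized 4 (real \<circ> alpha (table_graph pentagon)) (real \<circ> alpha (table_graph bulged_path))"
    unfolding majorized_def
    by (auto intro: bexI[of _ 1] bexI[of _ 2] simp: alpha_bulged_path alpha_pentagon not_le)
qed

text \<open>In both networks the ten distances add up to 15.\<close>

lemma avg_dist_examples:
  "avg_dist (table_graph bulged_path) = 3 / 2" "avg_dist (table_graph pentagon) = 3 / 2"
  unfolding avg_dist_def order_examples
  by (simp_all add: atLeastAtMost_1_4[simplified] alpha_bulged_path alpha_pentagon)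

lemma median_mset_10:
  assumes "sorted xs" "length xs = 10"
  shows "median (mset xs) = (real (xs ! 4) + real (xs ! 5)) / 2"
  using assms by (simp add: median_def sorted_list_of_multiset_mset sorted_sort_id)

lemma median_dist_examples:
  "median_dist (table_graph bulged_path) = 1" "median_dist (table_graph pentagon) = 3 / 2"
  \<comment> \<open>Without \<open>mset.simps\<close> the literal multisets stay of the form
    \<open>mset xs\<close>, as \<open>median_mset_10\<close> requires.\<close>
  by (simp_all add: median_dist_def distances_bulged_path distances_pentagon median_mset_10
      del: mset.simps)

theorem theorem5:
  shows "(\<forall>(G :: ('a, 'b) pre_digraph) (G' :: ('c, 'd) pre_digraph) N.
            network G \<and> network G' \<and> order G = N \<and> order G' = N \<and>
            majorized (N - 1) (real \<circ> alpha G) (real \<circ> alpha G') \<longrightarrow>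
              diameter G \<ge> diameter G' \<and>
              avg_dist G \<ge> avg_dist G' \<and>
              median_dist G \<ge> median_dist G')
       \<and> (\<exists>(G :: (nat, nat \<times> nat) pre_digraph) (G' :: (nat, nat \<times> nat) pre_digraph).
            network G \<and> network G' \<and> order G = order G' \<and>
            ranked (order G - 1) (real \<circ> alpha G) \<and> ranked (order G' - 1) (real \<circ> alpha G') \<and>
            \<not> majorized (order G - 1) (real \<circ> alpha G) (real \<circ> alpha G') \<and>
            diameter G \<ge> diameter G')
       \<and> (\<exists>(G :: (nat, nat \<times> nat) pre_digraph) (G' :: (nat, nat \<times> nat) pre_digraph).
            network G \<and> network G' \<and> order G = order G' \<and>
            ranked (order G - 1) (real \<circ> alpha G) \<and> ranked (order G' - 1) (real \<circ> alpha G') \<and>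
            \<not> majorized (order G - 1) (real \<circ> alpha G) (real \<circ> alpha G') \<and>
            avg_dist G \<ge> avg_dist G')
       \<and> (\<exists>(G :: (nat, nat \<times> nat) pre_digraph) (G' :: (nat, nat \<times> nat) pre_digraph).
            network G \<and> network G' \<and> order G = order G' \<and>
            ranked (order G - 1) (real \<circ> alpha G) \<and> ranked (order G' - 1) (real \<circ> alpha G') \<and>
            \<not> majorized (order G - 1) (real \<circ> alpha G) (real \<circ> alpha G') \<and>
            median_dist G \<ge> median_dist G')"
proof -
  note networks = network_table_graph[OF dist_table_bulged_path]
    network_table_graph[OF dist_table_pentagon]
  note examples = networks order_examples ranked_examples not_majorized_examples
    avg_dist_examples median_dist_examples
  have diameters: "diameter (table_graph pentagon) \<le> diameter (table_graph bulged_path)"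
    using diameter_bulged_path diameter_pentagon by linarith
  show ?thesis
  proof (intro conjI)
    show "\<forall>(G :: ('a, 'b) pre_digraph) (G' :: ('c, 'd) pre_digraph) N.
        network G \<and> network G' \<and> order G = N \<and> order G' = N \<and>
        majorized (N - 1) (real \<circ> alpha G) (real \<circ> alpha G') \<longrightarrow>
          diameter G \<ge> diameter G' \<and> avg_dist G \<ge> avg_dist G' \<and> median_dist G \<ge> median_dist G'"
      by (auto intro: majorized_network_le)
  \<comment> \<open>For diameter and average distance the bulged path comes first; for the median
    the pair is swapped, as the pentagon has the larger median. Majorization fails in either
    order.\<close>
  qed (rule exI[of _ "table_graph bulged_path"], rule exI[of _ "table_graph pentagon"],
       use examples diameters in simp,
     rule exI[of _ "table_graph bulged_path"], rule exI[of _ "table_graph pentagon"],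
       use examples in simp,
     rule exI[of _ "table_graph pentagon"], rule exI[of _ "table_graph bulged_path"],
       use examples in simp)
qed

end
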